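(* Let $n\ge 1$ be an integer. The OTOC magic $O_M$, defined on $n$-qubit unitary operators, satisfies: 1. (Faithfulness) $O_M(V)\ge 0$ for every $n$-qubit unitary $V$; and for an $n$-qubit unitary $U$, $O_M(U)=0$ if and only if $U$ is a Clifford unitary. 2. (Invariance) $O_M(U_1VU_2)=O_M(V)$ for every $n$-qubit unitary $V$ and all $n$-qubit Clifford unitaries $U_1,U_2$.
   Context: $\mathcal{P}_2^{\otimes n}$ denotes the set of $n$-qubit Pauli operators, i.e. $n$-fold tensor products of single-qubit operators from $\{I,X,Y,Z\}$ (Hermitian Pauli matrices). For a $2^n\times 2^n$ matrix $M$, $\langle M\rangle=\frac{1}{2^n}\mathrm{Tr}(M)$. The OTOC magic of an $n$-qubit unitary $U$ is $$O_M(U)=\max_{P,Q\in\mathcal{P}_2^{\otimes n}}\Big[1-\big|\langle U^\dagger P U\, Q\, U^\dagger P U\, Q\rangle\big|\Big].$$ A Clifford unitary is a unitary $U$ such that for every $P\in\mathcal{P}_2^{\otimes n}$, $U^\dagger PU$ is an element of $\mathcal{P}_2^{\otimes n}$ up to multiplication by a phase. *)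

theory Defs
  imports "Jordan_Normal_Form.Schur_Decomposition"
begin

definition kron :: "complex mat \<Rightarrow> complex mat \<Rightarrow> complex mat" where
  "kron A B = mat (dim_row A * dim_row B) (dim_col A * dim_col B)
     (\<lambda>(i, j). A $$ (i div dim_row B, j div dim_col B) * B $$ (i mod dim_row B, j mod dim_col B))"

(* The empty tensor product is the 1 x 1 identity, which is neutral for kron. *)
primrec kron_list :: "complex mat list \<Rightarrow> complex mat" where
  "kron_list [] = 1\<^sub>m 1"
| "kron_list (A # As) = kron A (kron_list As)"

definition pauli_X :: "complex mat" where
  "pauli_X = mat_of_rows_list 2 [[0, 1], [1, 0]]"

definition pauli_Y :: "complex mat" where
  "pauli_Y = mat_of_rows_list 2 [[0, - \<i>], [\<i>, 0]]"

definition pauli_Z :: "complex mat" where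
  "pauli_Z = mat_of_rows_list 2 [[1, 0], [0, - 1]]"

definition single_paulis :: "complex mat set" where
  "single_paulis = {1\<^sub>m 2, pauli_X, pauli_Y, pauli_Z}"

definition paulis :: "nat \<Rightarrow> complex mat set" where
  "paulis n = {kron_list Ps | Ps. length Ps = n \<and> set Ps \<subseteq> single_paulis}"

definition qubit_unitary :: "nat \<Rightarrow> complex mat \<Rightarrow> bool" where
  "qubit_unitary n U \<longleftrightarrow> U \<in> carrier_mat (2 ^ n) (2 ^ n)
     \<and> mat_adjoint U * U = 1\<^sub>m (2 ^ n) \<and> U * mat_adjoint U = 1\<^sub>m (2 ^ n)"

definition mat_trace :: "complex mat \<Rightarrow> complex" where
  "mat_trace M = (\<Sum>i<dim_row M. M $$ (i, i))"

definition norm_trace :: "nat \<Rightarrow> complex mat \<Rightarrow> complex" where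
  "norm_trace n M = 1 / 2 ^ n * mat_trace M"

definition otoc_magic :: "nat \<Rightarrow> complex mat \<Rightarrow> real" where
  "otoc_magic n U = Max ((\<lambda>(P, Q). 1 - cmod (norm_trace n
     (mat_adjoint U * P * U * Q * (mat_adjoint U * P * U) * Q))) ` (paulis n \<times> paulis n))"

definition clifford :: "nat \<Rightarrow> complex mat \<Rightarrow> bool" where
  "clifford n U \<longleftrightarrow> qubit_unitary n U \<and>
     (\<forall>P\<in>paulis n. \<exists>c. \<exists>Q\<in>paulis n. cmod c = 1 \<and> mat_adjoint U * P * U = c \<cdot>\<^sub>m Q)"

(* The maximum in otoc_magic ranges over a finite nonempty set, so Max is meaningful there. *)
lemma finite_paulis: "finite (paulis n)"
proof -
  have "finite {Ps. set Ps \<subseteq> single_paulis \<and> length Ps = n}"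
    by (rule finite_lists_length_eq) (simp add: single_paulis_def)
  moreover have "paulis n = kron_list ` {Ps. set Ps \<subseteq> single_paulis \<and> length Ps = n}"
    unfolding paulis_def by auto
  ultimately show ?thesis by simp
qed

lemma paulis_nonempty: "paulis n \<noteq> {}"
proof -
  have "kron_list (replicate n (1\<^sub>m 2)) \<in> paulis n"
    unfolding paulis_def single_paulis_def by (intro CollectI exI[of _ "replicate n (1\<^sub>m 2)"]) auto
  then show ?thesis by blast
qed

lemma paulis_carrier: "P \<in> paulis n \<Longrightarrow> P \<in> carrier_mat (2 ^ n) (2 ^ n)"
proof -
  have dims: "A \<in> carrier_mat 2 2" if "A \<in> single_paulis" for A
    using that by (auto simp: single_paulis_def pauli_X_def pauli_Y_def pauli_Z_def
        mat_of_rows_list_def)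
  have "kron_list Ps \<in> carrier_mat (2 ^ length Ps) (2 ^ length Ps)"
    if "set Ps \<subseteq> single_paulis" for Ps
    using that
  proof (induction Ps)
    case (Cons A Ps)
    then show ?case using dims[of A] by (auto simp: kron_def)
  qed simp
  then show "P \<in> paulis n \<Longrightarrow> P \<in> carrier_mat (2 ^ n) (2 ^ n)"
    unfolding paulis_def by auto
qed

end

theory Submission
  imports Defs
begin

(* A Pauli conjugate W = U^* P U has |<W Q W Q>| = 1 for a Pauli Q exactly when the unitary W Q W Q
   is scalar, that is, when W commutes with Q up to a scalar. A matrix with this property for all
   Paulis Q is a multiple of a Pauli (induction on the number of qubits, splitting off the first
   one), and this criterion shows in the same way that the adjoint of a Clifford unitary is
   Clifford. Invariance follows because conjugating P by U1 and Q by the adjoint of U2 only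
   moves the maximum to other Paulis. *)

section \<open>Adjoint and trace\<close>

text \<open>Two obstacles shape the argument. The induction that recognises Paulis passes from a
  unitary to its blocks, which need not be unitary and may vanish. Hence
  \<open>pauli_multiple_if_commutes\<close> treats arbitrary matrices and arbitrary complex scalars,
  with zero counting as a multiple of a Pauli, and the modulus of the scalar is recovered from
  unitarity only afterwards. The other obstacle is that \<open>clifford\<close> controls conjugation
  in one direction only. Counting Paulis up to phase would show that conjugation permutes them; the
  commutation criterion replaces this count, because commutation up to a scalar survives conjugation
  by a unitary. The link between trace and scalar matrices is an exact identity: the squared
  Frobenius distance from a unitary M to <M> times the identity is 2^n (1 - |<M>|^2). It gives both
  the bound |<M>| <= 1 and its equality case.\<close>

lemma mat_adjoint_index [simp]:
  fixes A :: "complex mat"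
  assumes "i < dim_col A" "j < dim_row A"
  shows "mat_adjoint A $$ (i, j) = cnj (A $$ (j, i))"
  using assms by (simp add: mat_adjoint_def mat_of_rows_def)

lemma mat_adjoint_dim [simp]:
  "dim_row (mat_adjoint A) = dim_col A" "dim_col (mat_adjoint A) = dim_row A"
  by (simp_all add: mat_adjoint_def)

lemma mat_adjoint_carrier [simp]:
  "A \<in> carrier_mat m n \<Longrightarrow> mat_adjoint A \<in> carrier_mat n m"
  by auto

lemma mat_adjoint_adjoint [simp]:
  fixes A :: "complex mat" shows "mat_adjoint (mat_adjoint A) = A"
  by (rule eq_matI) auto

lemma mat_adjoint_smult:
  fixes A :: "complex mat" shows "mat_adjoint (c \<cdot>\<^sub>m A) = cnj c \<cdot>\<^sub>m mat_adjoint A"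
  by (rule eq_matI) auto

lemma mat_adjoint_mult:
  fixes A B :: "complex mat"
  assumes "A \<in> carrier_mat m k" "B \<in> carrier_mat k n"
  shows "mat_adjoint (A * B) = mat_adjoint B * mat_adjoint A"
  using assms by (intro eq_matI) (auto simp: scalar_prod_def mult.commute)

lemma mat_trace_mult_commute:
  assumes "A \<in> carrier_mat m n" "B \<in> carrier_mat n m"
  shows "mat_trace (A * B) = mat_trace (B * A)"
proof -
  have "mat_trace (A * B) = (\<Sum>i<m. \<Sum>j<n. A $$ (i, j) * B $$ (j, i))"
    using assms by (auto simp: mat_trace_def scalar_prod_def atLeast0LessThan)
  also have "\<dots> = (\<Sum>j<n. \<Sum>i<m. B $$ (j, i) * A $$ (i, j))"
    by (subst sum.swap) (simp add: mult.commute)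
  also have "\<dots> = mat_trace (B * A)"
    using assms by (auto simp: mat_trace_def scalar_prod_def atLeast0LessThan)
  finally show ?thesis .
qed

lemma norm_trace_smult:
  assumes "A \<in> carrier_mat m m"
  shows "norm_trace n (c \<cdot>\<^sub>m A) = c * norm_trace n A"
  using assms by (simp add: norm_trace_def mat_trace_def sum_distrib_left ac_simps)

lemma norm_trace_one: "norm_trace n (1\<^sub>m (2 ^ n)) = 1"
  by (simp add: norm_trace_def mat_trace_def)

lemma smult_smult_mat: "c \<cdot>\<^sub>m (d \<cdot>\<^sub>m A) = (c * d) \<cdot>\<^sub>m (A :: 'a :: semigroup_mult mat)"
  by (rule eq_matI) (auto simp: mult.assoc)

lemma one_smult_mat: "1 \<cdot>\<^sub>m A = (A :: 'a :: monoid_mult mat)"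
  by (rule eq_matI) auto

text \<open>All dimensions are identified with one \<open>d\<close>, so that the simplifier can
  discharge the carrier premises; products become right-nested with scalars in front.\<close>

lemmas square_mat_simps = mult_carrier_mat[of _ d d _ d] assoc_mult_mat[of _ d d _ d _ d]
  mult_smult_distrib[of _ d d _ d] mult_smult_assoc_mat[of _ d d _ d] for d

lemma smult_mult_smult_mat:
  fixes A B :: "'a :: comm_semiring_0 mat"
  assumes "A \<in> carrier_mat d d" "B \<in> carrier_mat d d"
  shows "(a \<cdot>\<^sub>m A) * (b \<cdot>\<^sub>m B) = (a * b) \<cdot>\<^sub>m (A * B)"
  using assms by (simp add: square_mat_simps[where d = d] smult_smult_mat mult.commute)

section \<open>Unitary matrices\<close>

lemma qubit_unitaryD:
  assumes "qubit_unitary n U"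
  shows "U \<in> carrier_mat (2 ^ n) (2 ^ n)" "mat_adjoint U * U = 1\<^sub>m (2 ^ n)"
    "U * mat_adjoint U = 1\<^sub>m (2 ^ n)"
  using assms by (auto simp: qubit_unitary_def)

lemma qubit_unitary_adjoint: "qubit_unitary n U \<Longrightarrow> qubit_unitary n (mat_adjoint U)"
  by (auto simp: qubit_unitary_def)

text \<open>Right-nested normal forms hide the product of B and C, so cancelling an inverse pair is
  isolated here as a rule.\<close>

lemma cancel_middle:
  fixes A B C D :: "'a :: comm_ring_1 mat"
  assumes "A \<in> carrier_mat d d" "B \<in> carrier_mat d d" "C \<in> carrier_mat d d" "D \<in> carrier_mat d d"
    and "B * C = 1\<^sub>m d"
  shows "(A * B) * (C * D) = A * D"
proof -
  have "(A * B) * (C * D) = A * ((B * C) * D)"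
    using assms(1-4) by (simp add: square_mat_simps[where d = d])
  then show ?thesis using assms by simp
qed

lemma qubit_unitary_mult:
  assumes U: "qubit_unitary n U" and V: "qubit_unitary n V"
  shows "qubit_unitary n (U * V)"
proof -
  let ?d = "2 ^ n"
  note c = qubit_unitaryD(1)[OF U] qubit_unitaryD(1)[OF V]
  have ad: "mat_adjoint (U * V) = mat_adjoint V * mat_adjoint U"
    using c by (rule mat_adjoint_mult)
  have "(mat_adjoint V * mat_adjoint U) * (U * V) = mat_adjoint V * V"
    using c U by (intro cancel_middle[of _ ?d]) (auto simp: qubit_unitary_def)
  moreover have "(U * V) * (mat_adjoint V * mat_adjoint U) = U * mat_adjoint U"
    using c V by (intro cancel_middle[of _ ?d]) (auto simp: qubit_unitary_def)
  ultimately show ?thesis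
    using U V c by (auto simp: qubit_unitary_def ad)
qed

text \<open>Expand the square: the rows of M are unit vectors, so the entries contribute 2^n in
  total; the mixed terms contribute -2 * 2^n |l|^2 because the trace is 2^n l, and the scalar matrix
  contributes 2^n |l|^2.\<close>

lemma unitary_distance_to_scalar:
  fixes n :: nat
  assumes M: "qubit_unitary n M"
  defines "l \<equiv> norm_trace n M"
  shows "(\<Sum>i<2 ^ n. \<Sum>j<2 ^ n. (cmod (M $$ (i, j) - (if i = j then l else 0)))\<^sup>2)
    = 2 ^ n * (1 - (cmod l)\<^sup>2)"
proof -
  let ?d = "2 ^ n :: nat"
  note c = qubit_unitaryD(1)[OF M]
  have tr: "(\<Sum>i<?d. M $$ (i, i)) = of_nat ?d * l"
    using c by (simp add: l_def norm_trace_def mat_trace_def)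
  have row: "(\<Sum>j<?d. M $$ (i, j) * cnj (M $$ (i, j))) = 1" if i: "i < ?d" for i
  proof -
    have "(M * mat_adjoint M) $$ (i, i) = 1"
      using qubit_unitaryD(3)[OF M] i by simp
    then show ?thesis using c i by (simp add: scalar_prod_def atLeast0LessThan)
  qed
  \<comment> \<open>Over the complex numbers each squared modulus becomes z * cnj z; the terms with
    l survive only on the diagonal.\<close>
  have "complex_of_real (\<Sum>i<?d. \<Sum>j<?d. (cmod (M $$ (i, j) - (if i = j then l else 0)))\<^sup>2)
     = (\<Sum>i<?d. \<Sum>j<?d. M $$ (i, j) * cnj (M $$ (i, j))
         + (if i = j then l * cnj l - cnj l * M $$ (i, i) - l * cnj (M $$ (i, i)) else 0))"
    unfolding of_real_sum
    by (intro sum.cong refl) (auto simp only: complex_norm_square, auto simp: algebra_simps)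
  also have "\<dots> = (\<Sum>i<?d. 1 + (l * cnj l - cnj l * M $$ (i, i) - l * cnj (M $$ (i, i))))"
    by (intro sum.cong refl) (simp add: sum.distrib row)
  also have "\<dots> = of_nat ?d + (of_nat ?d * (l * cnj l) - cnj l * (\<Sum>i<?d. M $$ (i, i))
       - l * cnj (\<Sum>i<?d. M $$ (i, i)))"
    by (simp add: sum.distrib sum_subtractf sum_distrib_left)
  also have "\<dots> = of_nat ?d * (1 - l * cnj l)"
    unfolding tr by (simp add: algebra_simps)
  also have "\<dots> = complex_of_real (2 ^ n * (1 - (cmod l)\<^sup>2))"
    by (simp add: complex_norm_square[symmetric])
  finally show ?thesis by (simp only: of_real_eq_iff)
qed

lemma norm_trace_unitary_le_1:
  assumes "qubit_unitary n M"
  shows "cmod (norm_trace n M) \<le> 1"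
proof -
  have "0 \<le> (2::real) ^ n * (1 - (cmod (norm_trace n M))\<^sup>2)"
    unfolding unitary_distance_to_scalar[OF assms, symmetric] by (intro sum_nonneg) simp
  then have "(cmod (norm_trace n M))\<^sup>2 \<le> 1"
    by (smt (verit) mult_pos_neg zero_less_power)
  then show ?thesis by (simp add: power_le_one_iff abs_square_le_1)
qed

text \<open>The equality case of the bound: the distance to the scalar matrix is zero, hence so is
  each of its nonnegative summands.\<close>

lemma unitary_scalar_if_norm_trace:
  assumes M: "qubit_unitary n M" and 1: "cmod (norm_trace n M) = 1"
  shows "M = norm_trace n M \<cdot>\<^sub>m 1\<^sub>m (2 ^ n)"
proof (rule eq_matI)
  let ?d = "2 ^ n :: nat" and ?l = "norm_trace n M"
  fix i j assume "i < dim_row (?l \<cdot>\<^sub>m 1\<^sub>m (2 ^ n))" "j < dim_col (?l \<cdot>\<^sub>m 1\<^sub>m (2 ^ n))"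
  then have ij: "i < ?d" "j < ?d" by auto
  have "(\<Sum>i<?d. \<Sum>j<?d. (cmod (M $$ (i, j) - (if i = j then ?l else 0)))\<^sup>2) = 0"
    using unitary_distance_to_scalar[OF M] 1 by simp
  then have "\<forall>i<?d. \<forall>j<?d. (cmod (M $$ (i, j) - (if i = j then ?l else 0)))\<^sup>2 = 0"
    by (simp add: sum_nonneg_eq_0_iff sum_nonneg)
  then show "M $$ (i, j) = (?l \<cdot>\<^sub>m 1\<^sub>m (2 ^ n)) $$ (i, j)"
    using ij by auto
qed (use qubit_unitaryD(1)[OF M] in auto)

section \<open>Kronecker products with a 2 x 2 factor\<close>

text \<open>For indices below 2 * m, division by m gives the block number 0 or 1 and the remainder
  is the offset in the block. From here on div and mod can be replaced by block calculus.\<close>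

lemma kron_four_block:
  assumes A: "A \<in> carrier_mat 2 2" and B: "B \<in> carrier_mat m m"
  shows "kron A B = four_block_mat (A $$ (0, 0) \<cdot>\<^sub>m B) (A $$ (0, 1) \<cdot>\<^sub>m B)
    (A $$ (1, 0) \<cdot>\<^sub>m B) (A $$ (1, 1) \<cdot>\<^sub>m B)"
proof (rule eq_matI; (use assms in \<open>simp add: kron_def; fail\<close>)?)
  fix i j
  assume "i < dim_row (four_block_mat (A $$ (0, 0) \<cdot>\<^sub>m B) (A $$ (0, 1) \<cdot>\<^sub>m B)
    (A $$ (1, 0) \<cdot>\<^sub>m B) (A $$ (1, 1) \<cdot>\<^sub>m B))"
    "j < dim_col (four_block_mat (A $$ (0, 0) \<cdot>\<^sub>m B) (A $$ (0, 1) \<cdot>\<^sub>m B)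
    (A $$ (1, 0) \<cdot>\<^sub>m B) (A $$ (1, 1) \<cdot>\<^sub>m B))"
  then have ij: "i < 2 * m" "j < 2 * m" using B by auto
  have dm: "k div m = (if k < m then 0 else 1) \<and> k mod m = (if k < m then k else k - m)"
    if "k < 2 * m" for k
  proof (cases "k < m")
    case False
    then have "m > 0" "k = m + (k - m)" "k - m < m" using that by auto
    then show ?thesis using False
      by (metis add.commute div_add_self1 div_less mod_add_self1 mod_less not_gr0 One_nat_def plus_1_eq_Suc)
  qed simp
  show "kron A B $$ (i, j) = four_block_mat (A $$ (0, 0) \<cdot>\<^sub>m B) (A $$ (0, 1) \<cdot>\<^sub>m B)
    (A $$ (1, 0) \<cdot>\<^sub>m B) (A $$ (1, 1) \<cdot>\<^sub>m B) $$ (i, j)"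
    using ij dm[of i] dm[of j] A B by (auto simp: kron_def)
qed

lemma mult_2_2_index:
  fixes A B :: "'a :: comm_semiring_1 mat"
  assumes "A \<in> carrier_mat 2 2" "B \<in> carrier_mat 2 2" "i < 2" "j < 2"
  shows "(A * B) $$ (i, j) = A $$ (i, 0) * B $$ (0, j) + A $$ (i, 1) * B $$ (1, j)"
  using assms by (simp add: scalar_prod_def numeral_2_eq_2)

text \<open>Each block of the product is a sum of two multiples of B * D, and the coefficients add
  up to an entry of A * C.\<close>

lemma kron_mult:
  assumes A: "A \<in> carrier_mat 2 2" and B: "B \<in> carrier_mat m m"
    and C: "C \<in> carrier_mat 2 2" and D: "D \<in> carrier_mat m m"
  shows "kron A B * kron C D = kron (A * C) (B * D)"
proof -
  have 1: "(a \<cdot>\<^sub>m B) * (c \<cdot>\<^sub>m D) + (a' \<cdot>\<^sub>m B) * (c' \<cdot>\<^sub>m D) = (a * c + a' * c') \<cdot>\<^sub>m (B * D)"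
    for a c a' c'
    using B D
    by (simp add: square_mat_simps[where d = m] smult_smult_mat mult.commute
        add_smult_distrib_right_mat[of _ m m])
  have "kron A B * kron C D = four_block_mat
     ((A * C) $$ (0, 0) \<cdot>\<^sub>m (B * D)) ((A * C) $$ (0, 1) \<cdot>\<^sub>m (B * D))
     ((A * C) $$ (1, 0) \<cdot>\<^sub>m (B * D)) ((A * C) $$ (1, 1) \<cdot>\<^sub>m (B * D))"
    unfolding kron_four_block[OF A B] kron_four_block[OF C D]
    using A B C D
    by (simp add: mult_four_block_mat[of _ m m _ m _ m _ _ m _ m] 1 mult_2_2_index[OF A C]
        del: index_mult_mat(1))
  also have "\<dots> = kron (A * C) (B * D)"
    using A B C D by (intro kron_four_block[symmetric]) auto
  finally show ?thesis .
qed

lemma kron_smult_left: "kron (c \<cdot>\<^sub>m A) B = c \<cdot>\<^sub>m kron A B"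
  by (rule eq_matI) (auto simp: kron_def less_mult_imp_div_less)

lemma kron_smult_right: "kron A (c \<cdot>\<^sub>m B) = c \<cdot>\<^sub>m kron A B"
proof (rule eq_matI)
  fix i j assume "i < dim_row (c \<cdot>\<^sub>m kron A B)" "j < dim_col (c \<cdot>\<^sub>m kron A B)"
  then have ij: "i < dim_row A * dim_row B" "j < dim_col A * dim_col B" by (auto simp: kron_def)
  \<comment> \<open>Nonzero dimensions ensure that the remainders modulo them are valid indices of
    B.\<close>
  then have "dim_row B > 0" "dim_col B > 0" by (auto intro: Nat.gr0I)
  with ij show "kron A (c \<cdot>\<^sub>m B) $$ (i, j) = (c \<cdot>\<^sub>m kron A B) $$ (i, j)"
    by (auto simp: kron_def less_mult_imp_div_less)
qed (auto simp: kron_def)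

lemma mat_adjoint_kron: "mat_adjoint (kron A B) = kron (mat_adjoint A) (mat_adjoint B)"
proof (rule eq_matI)
  fix i j assume "i < dim_row (kron (mat_adjoint A) (mat_adjoint B))"
    "j < dim_col (kron (mat_adjoint A) (mat_adjoint B))"
  then have ij: "i < dim_col A * dim_col B" "j < dim_row A * dim_row B" by (auto simp: kron_def)
  then have "dim_row B > 0" "dim_col B > 0" by (auto intro: Nat.gr0I)
  with ij show "mat_adjoint (kron A B) $$ (i, j) = kron (mat_adjoint A) (mat_adjoint B) $$ (i, j)"
    by (auto simp: kron_def less_mult_imp_div_less)
qed (auto simp: kron_def)

lemma kron_one_one: "kron (1\<^sub>m 2) (1\<^sub>m m) = 1\<^sub>m (m + m)"
  by (subst kron_four_block[of _ _ m]) (auto intro!: eq_matI)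

section \<open>Pauli matrices\<close>

lemma single_paulis_carrier: "A \<in> single_paulis \<Longrightarrow> A \<in> carrier_mat 2 2"
  by (auto simp: single_paulis_def pauli_X_def pauli_Y_def pauli_Z_def mat_of_rows_list_def)

lemma eq_mat_2_2I:
  assumes "A \<in> carrier_mat 2 2" "B \<in> carrier_mat 2 2" "A $$ (0, 0) = B $$ (0, 0)"
    "A $$ (0, 1) = B $$ (0, 1)" "A $$ (1, 0) = B $$ (1, 0)" "A $$ (1, 1) = B $$ (1, 1)"
  shows "A = B"
  using assms by (intro eq_matI) (auto dest!: less_2_cases)

text \<open>Entries are listed for both 1 and \<open>Suc 0\<close>, since the simplifier turns the
  former index into the latter.\<close>

lemma pauli_X_index [simp]: "pauli_X $$ (0, 0) = 0" "pauli_X $$ (0, 1) = 1"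
    "pauli_X $$ (1, 0) = 1" "pauli_X $$ (1, 1) = 0"
    "pauli_X $$ (0, Suc 0) = 1" "pauli_X $$ (Suc 0, 0) = 1" "pauli_X $$ (Suc 0, Suc 0) = 0"
  and pauli_Y_index [simp]: "pauli_Y $$ (0, 0) = 0" "pauli_Y $$ (0, 1) = -\<i>"
    "pauli_Y $$ (1, 0) = \<i>" "pauli_Y $$ (1, 1) = 0"
    "pauli_Y $$ (0, Suc 0) = -\<i>" "pauli_Y $$ (Suc 0, 0) = \<i>" "pauli_Y $$ (Suc 0, Suc 0) = 0"
  and pauli_Z_index [simp]: "pauli_Z $$ (0, 0) = 1" "pauli_Z $$ (0, 1) = 0"
    "pauli_Z $$ (1, 0) = 0" "pauli_Z $$ (1, 1) = -1"
    "pauli_Z $$ (0, Suc 0) = 0" "pauli_Z $$ (Suc 0, 0) = 0" "pauli_Z $$ (Suc 0, Suc 0) = -1"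
  by (simp_all add: pauli_X_def pauli_Y_def pauli_Z_def mat_of_rows_list_def)

lemma single_paulis_dim:
  assumes "A \<in> single_paulis" shows "dim_row A = 2" "dim_col A = 2"
  using single_paulis_carrier[OF assms] by auto

lemma single_pauli_mem [simp]: "1\<^sub>m 2 \<in> single_paulis" "pauli_X \<in> single_paulis"
  "pauli_Y \<in> single_paulis" "pauli_Z \<in> single_paulis"
  by (auto simp: single_paulis_def)

lemmas single_pauli_carrier [simp] = single_pauli_mem[THEN single_paulis_carrier]
lemmas single_pauli_dim [simp] = single_pauli_mem[THEN single_paulis_dim(1)]
  single_pauli_mem[THEN single_paulis_dim(2)]

lemma single_pauli_square:
  assumes "A \<in> single_paulis" shows "A * A = 1\<^sub>m 2"
proof (rule eq_mat_2_2I)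
qed (use assms in \<open>auto simp: single_paulis_def mult_2_2_index simp del: index_mult_mat(1)\<close>)

lemma single_pauli_adjoint:
  assumes "A \<in> single_paulis" shows "mat_adjoint A = A"
proof (rule eq_mat_2_2I)
qed (use assms in \<open>auto simp: single_paulis_def\<close>)

lemma single_pauli_commute:
  assumes A: "A \<in> single_paulis" and B: "B \<in> single_paulis"
  shows "A * B = B * A \<or> A * B = (-1) \<cdot>\<^sub>m (B * A)"
proof -
  note c = single_paulis_carrier[OF A] single_paulis_carrier[OF B]
  \<comment> \<open>With matrix equality reduced to four entries, both alternatives can be computed
    for each of the 16 pairs.\<close>
  have eq: "X = Y \<longleftrightarrow> X $$ (0, 0) = Y $$ (0, 0) \<and> X $$ (0, 1) = Y $$ (0, 1) \<and>
      X $$ (1, 0) = Y $$ (1, 0) \<and> X $$ (1, 1) = Y $$ (1, 1)"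
    if "X \<in> carrier_mat 2 2" "Y \<in> carrier_mat 2 2" for X Y :: "complex mat"
    using that by (auto intro: eq_mat_2_2I)
  have AB: "A * B \<in> carrier_mat 2 2" "B * A \<in> carrier_mat 2 2" "(-1) \<cdot>\<^sub>m (B * A) \<in> carrier_mat 2 2"
    using c by auto
  have sm: "((-1) \<cdot>\<^sub>m (B * A)) $$ (i, j) = - ((B * A) $$ (i, j))" if "i < 2" "j < 2" for i j
    using c that by simp
  show ?thesis
    unfolding eq[OF AB(1,2)] eq[OF AB(1,3)]
    using A B
    by (auto simp: sm mult_2_2_index[OF c] mult_2_2_index[OF c(2,1)] single_paulis_def
        simp del: index_mult_mat(1) index_smult_mat(1))
qed

section \<open>Tensor products of Pauli matrices\<close>

lemma paulis_0: "paulis 0 = {1\<^sub>m 1}"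
  by (auto simp: paulis_def)

lemma paulis_Suc: "paulis (Suc n) = {kron A P | A P. A \<in> single_paulis \<and> P \<in> paulis n}"
proof -
  have "kron A P \<in> paulis (Suc n)" if A: "A \<in> single_paulis" and P: "P \<in> paulis n" for A P
  proof -
    obtain Ps where "P = kron_list Ps" "length Ps = n" "set Ps \<subseteq> single_paulis"
      using P by (auto simp: paulis_def)
    then show ?thesis
      using A unfolding paulis_def by (intro CollectI exI[of _ "A # Ps"]) auto
  qed
  then show ?thesis by (fastforce simp: paulis_def length_Suc_conv)
qed

lemma one_in_paulis: "1\<^sub>m (2 ^ n) \<in> paulis n"
proof (induction n)
  case (Suc n)
  have "kron (1\<^sub>m 2) (1\<^sub>m (2 ^ n)) \<in> paulis (Suc n)"
    unfolding paulis_Suc using Suc single_pauli_mem(1) by blast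
  then show ?case by (simp add: kron_one_one mult_2)
qed (simp add: paulis_0)

lemma pauli_square: "P \<in> paulis n \<Longrightarrow> P * P = 1\<^sub>m (2 ^ n)"
proof (induction n arbitrary: P)
  case (Suc n)
  then obtain A R where P: "P = kron A R" "A \<in> single_paulis" "R \<in> paulis n"
    by (auto simp: paulis_Suc)
  then show ?case
    using kron_mult[OF single_paulis_carrier paulis_carrier single_paulis_carrier paulis_carrier]
      Suc.IH[of R] by (simp add: single_pauli_square kron_one_one mult_2)
qed (simp add: paulis_0)

lemma pauli_adjoint: "P \<in> paulis n \<Longrightarrow> mat_adjoint P = P"
  by (induction n arbitrary: P)
    (auto simp: paulis_0 paulis_Suc mat_adjoint_kron single_pauli_adjoint)

lemma pauli_unitary: "P \<in> paulis n \<Longrightarrow> qubit_unitary n P"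
  by (simp add: qubit_unitary_def pauli_adjoint pauli_square paulis_carrier)

text \<open>The commutation signs of the tensor factors multiply. The factor is kept as a phase of
  modulus 1, which is all that the absolute value of a trace detects.\<close>

lemma pauli_commute:
  assumes "P \<in> paulis n" "Q \<in> paulis n"
  shows "\<exists>s. cmod s = 1 \<and> P * Q = s \<cdot>\<^sub>m (Q * P)"
  using assms
proof (induction n arbitrary: P Q)
  case 0
  then show ?case by (intro exI[of _ 1]) (auto simp: paulis_0)
next
  case (Suc n)
  obtain A R where P: "P = kron A R" "A \<in> single_paulis" "R \<in> paulis n"
    using Suc.prems by (auto simp: paulis_Suc)
  obtain B S where Q: "Q = kron B S" "B \<in> single_paulis" "S \<in> paulis n"
    using Suc.prems by (auto simp: paulis_Suc)
  note cr = single_paulis_carrier[OF P(2)] paulis_carrier[OF P(3)]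
    single_paulis_carrier[OF Q(2)] paulis_carrier[OF Q(3)]
  obtain s where s: "cmod s = 1" "R * S = s \<cdot>\<^sub>m (S * R)" using Suc.IH P Q by blast
  obtain t :: complex where t: "cmod t = 1" "A * B = t \<cdot>\<^sub>m (B * A)"
  proof (cases "A * B = B * A")
    case True
    then show ?thesis by (intro that[of 1]) (auto intro!: eq_matI)
  next
    case False
    then show ?thesis using single_pauli_commute[OF P(2) Q(2)] that[of "-1"] by auto
  qed
  have "P * Q = kron (A * B) (R * S)"
    unfolding P(1) Q(1) by (rule kron_mult[OF cr])
  also have "\<dots> = (s * t) \<cdot>\<^sub>m kron (B * A) (S * R)"
    by (simp add: s t kron_smult_left kron_smult_right smult_smult_mat mult.commute)
  also have "kron (B * A) (S * R) = Q * P"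
    unfolding P(1) Q(1) using cr by (intro kron_mult[symmetric])
  finally show ?case using s t by (intro exI[of _ "s * t"]) (simp add: norm_mult)
qed

section \<open>Matrices commuting with all Paulis up to scalars\<close>

lemma four_block_mat_inject:
  assumes "A \<in> carrier_mat m m" "B \<in> carrier_mat m m" "C \<in> carrier_mat m m" "D \<in> carrier_mat m m"
    "A' \<in> carrier_mat m m" "B' \<in> carrier_mat m m" "C' \<in> carrier_mat m m" "D' \<in> carrier_mat m m"
    and eq: "four_block_mat A B C D = four_block_mat A' B' C' D'"
  shows "A = A'" "B = B'" "C = C'" "D = D'"
proof -
  have e: "four_block_mat A B C D $$ (i, j) = four_block_mat A' B' C' D' $$ (i, j)" for i j
    using eq by simp
  show "A = A'"
  proof (rule eq_matI)
    fix i j assume "i < dim_row A'" "j < dim_col A'"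
    then show "A $$ (i, j) = A' $$ (i, j)" using e[of i j] assms(1-8) by simp
  qed (use assms in auto)
  show "B = B'"
  proof (rule eq_matI)
    fix i j assume "i < dim_row B'" "j < dim_col B'"
    then show "B $$ (i, j) = B' $$ (i, j)" using e[of i "m + j"] assms(1-8) by simp
  qed (use assms in auto)
  show "C = C'"
  proof (rule eq_matI)
    fix i j assume "i < dim_row C'" "j < dim_col C'"
    then show "C $$ (i, j) = C' $$ (i, j)" using e[of "m + i" j] assms(1-8) by simp
  qed (use assms in auto)
  show "D = D'"
  proof (rule eq_matI)
    fix i j assume "i < dim_row D'" "j < dim_col D'"
    then show "D $$ (i, j) = D' $$ (i, j)" using e[of "m + i" "m + j"] assms(1-8) by simp
  qed (use assms in auto)
qed

lemma smult_self_eq: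
  fixes A :: "complex mat"
  assumes "A = c \<cdot>\<^sub>m A"
  shows "c = 1 \<or> A = 0\<^sub>m (dim_row A) (dim_col A)"
proof (cases "c = 1")
  case False
  have "A $$ (i, j) = 0" if "i < dim_row A" "j < dim_col A" for i j
  proof -
    have "A $$ (i, j) = c * A $$ (i, j)"
      using arg_cong[OF assms, of "\<lambda>A. A $$ (i, j)"] that by simp
    then show ?thesis using False by simp
  qed
  then have "A = 0\<^sub>m (dim_row A) (dim_col A)" by (intro eq_matI) auto
  then show ?thesis ..
qed simp

text \<open>Substituting one equation into the other gives A = c^2 A. So either c is 1 or -1, or A
  vanishes and D with it.\<close>

lemma smult_swap_sign:
  fixes A D :: "complex mat"
  assumes "A \<in> carrier_mat m m" "A = c \<cdot>\<^sub>m D" "D = c \<cdot>\<^sub>m A"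
  shows "D = A \<or> D = (-1) \<cdot>\<^sub>m A"
proof -
  have "A = (c * c) \<cdot>\<^sub>m A" using assms(2,3) by (metis smult_smult_mat)
  then consider "c * c = 1" | "A = 0\<^sub>m m m"
    using smult_self_eq[of A "c * c"] assms(1) by auto
  then show ?thesis
  proof cases
    case 1
    then have "c = 1 \<or> c = -1" by (simp add: square_eq_1_iff)
    then show ?thesis
    proof
      assume "c = 1"
      then show ?thesis using assms(3) by (auto intro!: eq_matI)
    qed (use assms(3) in auto)
  next
    case 2
    then show ?thesis using assms(3) by auto
  qed
qed

lemma kron_pauli_four_block:
  fixes P :: "complex mat"
  assumes P: "P \<in> carrier_mat m m"
  shows "kron (1\<^sub>m 2) P = four_block_mat P (0\<^sub>m m m) (0\<^sub>m m m) P"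
    "kron pauli_X P = four_block_mat (0\<^sub>m m m) P P (0\<^sub>m m m)"
    "kron pauli_Y P = four_block_mat (0\<^sub>m m m) (-\<i> \<cdot>\<^sub>m P) (\<i> \<cdot>\<^sub>m P) (0\<^sub>m m m)"
    "kron pauli_Z P = four_block_mat P (0\<^sub>m m m) (0\<^sub>m m m) ((-1) \<cdot>\<^sub>m P)"
proof -
  have *: "0 \<cdot>\<^sub>m P = 0\<^sub>m m m" "1 \<cdot>\<^sub>m P = P" using P by (auto intro!: eq_matI)
  show "kron (1\<^sub>m 2) P = four_block_mat P (0\<^sub>m m m) (0\<^sub>m m m) P"
    "kron pauli_X P = four_block_mat (0\<^sub>m m m) P P (0\<^sub>m m m)"
    "kron pauli_Y P = four_block_mat (0\<^sub>m m m) (-\<i> \<cdot>\<^sub>m P) (\<i> \<cdot>\<^sub>m P) (0\<^sub>m m m)"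
    "kron pauli_Z P = four_block_mat P (0\<^sub>m m m) (0\<^sub>m m m) ((-1) \<cdot>\<^sub>m P)"
    by (subst kron_four_block[of _ _ m], use P in \<open>simp_all add: *\<close>)+
qed

text \<open>Write W in blocks A, B, C, D according to the first qubit. Testing with Z and X on that
  qubit leaves only the block patterns of 1, Z, X and Y; testing with the identity on it passes the
  hypothesis to the blocks A and B.\<close>

lemma pauli_multiple_if_commutes:
  assumes "W \<in> carrier_mat (2 ^ n) (2 ^ n)"
    and "\<And>Q. Q \<in> paulis n \<Longrightarrow> \<exists>l. W * Q = l \<cdot>\<^sub>m (Q * W)"
  shows "\<exists>c. \<exists>P\<in>paulis n. W = c \<cdot>\<^sub>m P"
  using assms
proof (induction n arbitrary: W)
  case 0
  then have "W = W $$ (0, 0) \<cdot>\<^sub>m 1\<^sub>m 1" by (intro eq_matI) auto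
  then show ?case by (auto simp: paulis_0)
next
  case (Suc n)
  define m :: nat where "m = 2 ^ n"
  have W: "W \<in> carrier_mat (m + m) (m + m)" using Suc.prems(1) by (simp add: m_def mult_2)
  obtain A B C D where "split_block W m m = (A, B, C, D)" by (metis prod_cases4)
  from split_block[OF this, of m m] W
  have cr: "A \<in> carrier_mat m m" "B \<in> carrier_mat m m" "C \<in> carrier_mat m m" "D \<in> carrier_mat m m"
    and W_eq: "W = four_block_mat A B C D" by auto
  have pc: "P \<in> carrier_mat m m" if "P \<in> paulis n" for P
    using paulis_carrier[OF that] by (simp add: m_def)
  have one: "1\<^sub>m m \<in> paulis n" using one_in_paulis by (simp add: m_def)
  have mem: "kron T R \<in> paulis (Suc n)" if "T \<in> single_paulis" "R \<in> paulis n" for T R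
    using that unfolding paulis_Suc by auto
  \<comment> \<open>Z on the first qubit separates the block-diagonal case (l = 1) from the
    block-antidiagonal one; X ties D to A and C to B.\<close>
  obtain l where l: "W * kron pauli_Z (1\<^sub>m m) = l \<cdot>\<^sub>m (kron pauli_Z (1\<^sub>m m) * W)"
    using Suc.prems(2)[OF mem[OF _ one]] single_pauli_mem by blast
  obtain k where k: "W * kron pauli_X (1\<^sub>m m) = k \<cdot>\<^sub>m (kron pauli_X (1\<^sub>m m) * W)"
    using Suc.prems(2)[OF mem[OF _ one]] single_pauli_mem by blast
  have neg: "A * ((-1) \<cdot>\<^sub>m 1\<^sub>m m) = (-1) \<cdot>\<^sub>m A" "((-1) \<cdot>\<^sub>m 1\<^sub>m m) * A = (-1) \<cdot>\<^sub>m A"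
    if "A \<in> carrier_mat m m" for A :: "complex mat"
    using that by (auto simp: mult_smult_distrib[of A m m "1\<^sub>m m" m] mult_smult_assoc_mat[of "1\<^sub>m m" m m A m])
  have "four_block_mat A ((-1) \<cdot>\<^sub>m B) C ((-1) \<cdot>\<^sub>m D)
      = four_block_mat (l \<cdot>\<^sub>m A) (l \<cdot>\<^sub>m B) (l \<cdot>\<^sub>m ((-1) \<cdot>\<^sub>m C)) (l \<cdot>\<^sub>m ((-1) \<cdot>\<^sub>m D))"
    using l cr unfolding W_eq kron_pauli_four_block(4)[OF one_carrier_mat]
    by (simp add: mult_four_block_mat[of _ m m _ m _ m _ _ m _ m] neg smult_four_block_mat[of _ m m _ m _ m])
  from four_block_mat_inject[OF _ _ _ _ _ _ _ _ this] cr
  have Z: "A = l \<cdot>\<^sub>m A" "(-1) \<cdot>\<^sub>m B = l \<cdot>\<^sub>m B" "C = l \<cdot>\<^sub>m ((-1) \<cdot>\<^sub>m C)"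
     "(-1) \<cdot>\<^sub>m D = l \<cdot>\<^sub>m ((-1) \<cdot>\<^sub>m D)" by auto
  have "four_block_mat B A D C
      = four_block_mat (k \<cdot>\<^sub>m C) (k \<cdot>\<^sub>m D) (k \<cdot>\<^sub>m A) (k \<cdot>\<^sub>m B)"
    using k cr unfolding W_eq kron_pauli_four_block(2)[OF one_carrier_mat]
    by (simp add: mult_four_block_mat[of _ m m _ m _ m _ _ m _ m] smult_four_block_mat[of _ m m _ m _ m])
  from four_block_mat_inject[OF _ _ _ _ _ _ _ _ this] cr
  have X: "B = k \<cdot>\<^sub>m C" "A = k \<cdot>\<^sub>m D" "D = k \<cdot>\<^sub>m A" "C = k \<cdot>\<^sub>m B" by auto
  have AD: "D = A \<or> D = (-1) \<cdot>\<^sub>m A" using smult_swap_sign[OF cr(1) X(2,3)] .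
  have BC: "C = B \<or> C = (-1) \<cdot>\<^sub>m B" using smult_swap_sign[OF cr(2) X(1,4)] .
  \<comment> \<open>The identity on the first qubit lets R act on each block separately, so the same
    scalar v serves for A and B.\<close>
  have inner: "\<exists>v. A * R = v \<cdot>\<^sub>m (R * A) \<and> B * R = v \<cdot>\<^sub>m (R * B)" if R: "R \<in> paulis n" for R
  proof -
    obtain v where v: "W * kron (1\<^sub>m 2) R = v \<cdot>\<^sub>m (kron (1\<^sub>m 2) R * W)"
      using Suc.prems(2)[OF mem[OF _ R]] single_pauli_mem by blast
    have "four_block_mat (A * R) (B * R) (C * R) (D * R) =
        four_block_mat (v \<cdot>\<^sub>m (R * A)) (v \<cdot>\<^sub>m (R * B)) (v \<cdot>\<^sub>m (R * C)) (v \<cdot>\<^sub>m (R * D))"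
      using v cr pc[OF R] unfolding W_eq kron_pauli_four_block(1)[OF pc[OF R]]
      by (simp add: mult_four_block_mat[of _ m m _ m _ m _ _ m _ m] smult_four_block_mat[of _ m m _ m _ m])
    from four_block_mat_inject(1,2)[where m = m, OF _ _ _ _ _ _ _ _ this] cr pc[OF R]
    show ?thesis by (intro exI[of _ v]) auto
  qed
  have "\<exists>c. \<exists>P\<in>paulis n. A = c \<cdot>\<^sub>m P" "\<exists>c. \<exists>P\<in>paulis n. B = c \<cdot>\<^sub>m P"
    using Suc.IH[of A] Suc.IH[of B] inner cr unfolding m_def by blast+
  then obtain a b P Q where AP: "A = a \<cdot>\<^sub>m P" "P \<in> paulis n" and BQ: "B = b \<cdot>\<^sub>m Q" "Q \<in> paulis n"
    by blast
  show ?case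
  proof (cases "l = 1")
    case True
    \<comment> \<open>For l = 1 the upper right blocks in the Z relation give -B = B, so B vanishes,
      and C = k B vanishes too.\<close>
    have "B = (-1) \<cdot>\<^sub>m B" using Z(2) True by (simp add: one_smult_mat)
    then have B0: "B = 0\<^sub>m m m" using smult_self_eq[of B "-1"] cr by auto
    then have C0: "C = 0\<^sub>m m m" using X(4) by simp
    from AD show ?thesis
    proof
      assume "D = A"
      then have "W = a \<cdot>\<^sub>m kron (1\<^sub>m 2) P"
        using pc[OF AP(2)] W_eq B0 C0 AP(1) by (simp add: kron_pauli_four_block smult_four_block_mat[of _ m m _ m _ m])
      then show ?thesis using mem[OF _ AP(2)] single_pauli_mem by blast
    next
      assume "D = (-1) \<cdot>\<^sub>m A"
      then have "W = a \<cdot>\<^sub>m kron pauli_Z P"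
        using pc[OF AP(2)] W_eq B0 C0 AP(1)
        by (simp add: kron_pauli_four_block smult_four_block_mat[of _ m m _ m _ m] smult_smult_mat)
      then show ?thesis using mem[OF _ AP(2)] single_pauli_mem by blast
    qed
  next
    case False
    \<comment> \<open>For l different from 1 the relation A = l A kills A, and then D = k A.\<close>
    have A0: "A = 0\<^sub>m m m" using smult_self_eq[OF Z(1)] False cr by auto
    then have D0: "D = 0\<^sub>m m m" using X(3) by simp
    from BC show ?thesis
    proof
      assume "C = B"
      then have "W = b \<cdot>\<^sub>m kron pauli_X Q"
        using pc[OF BQ(2)] W_eq A0 D0 BQ(1) by (simp add: kron_pauli_four_block smult_four_block_mat[of _ m m _ m _ m])
      then show ?thesis using mem[OF _ BQ(2)] single_pauli_mem by blast
    next
      assume "C = (-1) \<cdot>\<^sub>m B"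
      \<comment> \<open>The off-diagonal entries of Y are -i and i; the factor i turns them into 1
        and -1, the pattern of B and -B.\<close>
      moreover have ib: "\<i> * b * \<i> = - b" by (simp add: complex_eq_iff)
      ultimately have "W = (\<i> * b) \<cdot>\<^sub>m kron pauli_Y Q"
        using pc[OF BQ(2)] W_eq A0 D0 BQ(1) ib
        by (simp add: kron_pauli_four_block smult_four_block_mat[of _ m m _ m _ m] smult_smult_mat)
      then show ?thesis using mem[OF _ BQ(2)] single_pauli_mem by blast
    qed
  qed
qed

text \<open>Since P is Hermitian and squares to the identity, the adjoint of W times W is |c|^2
  times the identity; unitarity then forces |c| = 1.\<close>

lemma pauli_phase_if_commutes:
  assumes W: "qubit_unitary n W"
    and "\<And>Q. Q \<in> paulis n \<Longrightarrow> \<exists>l. W * Q = l \<cdot>\<^sub>m (Q * W)"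
  shows "\<exists>c. \<exists>P\<in>paulis n. cmod c = 1 \<and> W = c \<cdot>\<^sub>m P"
proof -
  obtain c P where P: "P \<in> paulis n" "W = c \<cdot>\<^sub>m P"
    using pauli_multiple_if_commutes[OF qubit_unitaryD(1)[OF W] assms(2)] by blast
  note pc = paulis_carrier[OF P(1)]
  have "1\<^sub>m (2 ^ n) = (cnj c \<cdot>\<^sub>m P) * (c \<cdot>\<^sub>m P)"
    using qubit_unitaryD(2)[OF W] by (simp add: P mat_adjoint_smult pauli_adjoint[OF P(1)])
  also have "\<dots> = (cnj c * c) \<cdot>\<^sub>m 1\<^sub>m (2 ^ n)"
    using pc pauli_square[OF P(1)]
    by (simp add: square_mat_simps[where d = "2 ^ n"] smult_smult_mat mult.commute)
  \<comment> \<open>The entry (0, 0) exists because 2^n is positive.\<close>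
  finally have "1\<^sub>m (2 ^ n) $$ (0, 0) = ((cnj c * c) \<cdot>\<^sub>m 1\<^sub>m (2 ^ n)) $$ (0, 0)"
    by (rule arg_cong)
  then have "c * cnj c = 1"
    by (simp add: mult.commute)
  then have "complex_of_real ((cmod c)\<^sup>2) = 1"
    by (simp only: complex_norm_square)
  then have "(cmod c)\<^sup>2 = 1" by (simp only: of_real_eq_1_iff)
  then have "cmod c = 1" by (simp add: power2_eq_1_iff) (smt (verit) norm_ge_zero)
  with P show ?thesis by blast
qed

section \<open>Clifford unitaries\<close>

lemma cliffordD:
  assumes "clifford n U"
  shows "qubit_unitary n U"
    "P \<in> paulis n \<Longrightarrow> \<exists>c. \<exists>Q\<in>paulis n. cmod c = 1 \<and> mat_adjoint U * P * U = c \<cdot>\<^sub>m Q"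
  using assms unfolding clifford_def by blast+

lemma conjugate_unitary:
  "qubit_unitary n U \<Longrightarrow> P \<in> paulis n \<Longrightarrow> qubit_unitary n (mat_adjoint U * P * U)"
  by (simp add: qubit_unitary_mult qubit_unitary_adjoint pauli_unitary)

lemma conjugate_mult:
  assumes U: "qubit_unitary n U" and A: "A \<in> carrier_mat (2 ^ n) (2 ^ n)"
    and B: "B \<in> carrier_mat (2 ^ n) (2 ^ n)"
  shows "(mat_adjoint U * A * U) * (mat_adjoint U * B * U) = mat_adjoint U * (A * B) * U"
proof -
  note c = qubit_unitaryD(1)[OF U] mat_adjoint_carrier[OF qubit_unitaryD(1)[OF U]]
  have "(mat_adjoint U * A * U) * (mat_adjoint U * (B * U)) = (mat_adjoint U * A) * (B * U)"
    using c A B qubit_unitaryD(3)[OF U] by (intro cancel_middle[of _ "2 ^ n"]) auto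
  then show ?thesis
    using c A B by (simp add: square_mat_simps[where d = "2 ^ n"])
qed

lemma conjugate_smult:
  assumes "U \<in> carrier_mat d d" "A \<in> carrier_mat d d"
  shows "mat_adjoint U * (c \<cdot>\<^sub>m A) * U = c \<cdot>\<^sub>m (mat_adjoint U * A * U :: complex mat)"
  using assms
  by (simp add: square_mat_simps[where d = d])

lemma conjugate_cancel:
  assumes U: "qubit_unitary n U" and A: "A \<in> carrier_mat (2 ^ n) (2 ^ n)"
  shows "mat_adjoint U * (U * A * mat_adjoint U) * U = A"
proof -
  note c = qubit_unitaryD(1)[OF U] mat_adjoint_carrier[OF qubit_unitaryD(1)[OF U]]
  have "mat_adjoint U * (U * A * mat_adjoint U) * U
      = (mat_adjoint U * U) * A * (mat_adjoint U * U)"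
    using c A
    by (simp add: square_mat_simps[where d = "2 ^ n"])
  then show ?thesis using A qubit_unitaryD(2)[OF U] by simp
qed

text \<open>To test the conjugate of P by the adjoint against a Pauli Q, move Q to the other side:
  conjugation by U makes it a phase times a Pauli R, which commutes with P up to a scalar.
  Conjugating back transfers this relation to Q.\<close>

lemma clifford_adjoint:
  assumes "clifford n U"
  shows "clifford n (mat_adjoint U)"
proof -
  let ?d = "2 ^ n :: nat"
  note U = cliffordD(1)[OF assms]
  note U' = qubit_unitary_adjoint[OF U]
  note c = qubit_unitaryD(1)[OF U] qubit_unitaryD(1)[OF U']
  have "\<exists>c. \<exists>Q\<in>paulis n. cmod c = 1 \<and> mat_adjoint (mat_adjoint U) * P * mat_adjoint U = c \<cdot>\<^sub>m Q"
    if P: "P \<in> paulis n" for P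
  proof (rule pauli_phase_if_commutes[OF conjugate_unitary[OF U' P]])
    fix Q assume Q: "Q \<in> paulis n"
    obtain a R where R: "R \<in> paulis n" "mat_adjoint U * Q * U = a \<cdot>\<^sub>m R"
      using cliffordD(2)[OF assms Q] by blast
    obtain s where s: "P * R = s \<cdot>\<^sub>m (R * P)" using pauli_commute[OF P R(1)] by blast
    note pc = paulis_carrier[OF P] paulis_carrier[OF Q] paulis_carrier[OF R(1)]
    have QR: "Q = mat_adjoint (mat_adjoint U) * (a \<cdot>\<^sub>m R) * mat_adjoint U"
      using conjugate_cancel[OF U' pc(2)] R(2) by simp
    have eq: "P * (a \<cdot>\<^sub>m R) = s \<cdot>\<^sub>m ((a \<cdot>\<^sub>m R) * P)"
      using pc s by (simp add: square_mat_simps[where d = ?d] smult_smult_mat mult.commute)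
    let ?W = "mat_adjoint (mat_adjoint U) * P * mat_adjoint U"
    have "?W * Q = mat_adjoint (mat_adjoint U) * (P * (a \<cdot>\<^sub>m R)) * mat_adjoint U"
      unfolding QR using pc by (intro conjugate_mult[OF U']) auto
    also have "\<dots> = s \<cdot>\<^sub>m (mat_adjoint (mat_adjoint U) * ((a \<cdot>\<^sub>m R) * P) * mat_adjoint U)"
      unfolding eq using pc c by (intro conjugate_smult[of _ ?d]) auto
    also have "mat_adjoint (mat_adjoint U) * ((a \<cdot>\<^sub>m R) * P) * mat_adjoint U = Q * ?W"
      unfolding QR using pc by (intro conjugate_mult[OF U', symmetric]) auto
    finally show "\<exists>l. ?W * Q = l \<cdot>\<^sub>m (Q * ?W)" ..
  qed
  then show ?thesis unfolding clifford_def using U' by blast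
qed

section \<open>OTOC magic\<close>

text \<open>The modulus of the out-of-time-order correlator, separated from the maximum so that it
  can be studied pair by pair.\<close>

definition otoc :: "nat \<Rightarrow> complex mat \<Rightarrow> complex mat \<Rightarrow> complex mat \<Rightarrow> real" where
  "otoc n U P Q = cmod (norm_trace n
     (mat_adjoint U * P * U * Q * (mat_adjoint U * P * U) * Q))"

lemma otoc_magic_alt:
  "otoc_magic n U = Max ((\<lambda>(P, Q). 1 - otoc n U P Q) ` (paulis n \<times> paulis n))"
  by (simp add: otoc_magic_def otoc_def)

lemma otoc_magic_ge:
  "P \<in> paulis n \<Longrightarrow> Q \<in> paulis n \<Longrightarrow> 1 - otoc n U P Q \<le> otoc_magic n U"
  unfolding otoc_magic_alt by (intro Max_ge) (auto simp: finite_paulis intro!: imageI)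

lemma otoc_magic_attained:
  obtains P Q where "P \<in> paulis n" "Q \<in> paulis n" "otoc_magic n U = 1 - otoc n U P Q"
proof -
  have "otoc_magic n U \<in> (\<lambda>(P, Q). 1 - otoc n U P Q) ` (paulis n \<times> paulis n)"
    unfolding otoc_magic_alt by (intro Max_in) (auto simp: finite_paulis paulis_nonempty)
  then show ?thesis using that by auto
qed

section \<open>Faithfulness\<close>

lemma otoc_unitary:
  assumes "qubit_unitary n U" "P \<in> paulis n" "Q \<in> paulis n"
  shows "qubit_unitary n (mat_adjoint U * P * U * Q * (mat_adjoint U * P * U) * Q)"
  using assms
  by (simp add: qubit_unitary_mult conjugate_unitary pauli_unitary)

lemma otoc_le_1:
  "qubit_unitary n U \<Longrightarrow> P \<in> paulis n \<Longrightarrow> Q \<in> paulis n \<Longrightarrow> otoc n U P Q \<le> 1"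
  unfolding otoc_def by (intro norm_trace_unitary_le_1 otoc_unitary)

lemma otoc_magic_nonneg:
  assumes "qubit_unitary n U"
  shows "otoc_magic n U \<ge> 0"
  using otoc_le_1[OF assms] by (metis diff_ge_0_iff_ge otoc_magic_attained)

text \<open>All the terms 1 - \<open>otoc n U P Q\<close> are nonnegative, so their maximum vanishes
  only if each of them does.\<close>

lemma otoc_magic_eq_0_iff:
  assumes "qubit_unitary n U"
  shows "otoc_magic n U = 0 \<longleftrightarrow> (\<forall>P\<in>paulis n. \<forall>Q\<in>paulis n. otoc n U P Q = 1)"
proof
  assume "otoc_magic n U = 0"
  then show "\<forall>P\<in>paulis n. \<forall>Q\<in>paulis n. otoc n U P Q = 1"
    using otoc_magic_ge[of _ n _ U] otoc_le_1[OF assms] by (smt (verit))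
next
  assume "\<forall>P\<in>paulis n. \<forall>Q\<in>paulis n. otoc n U P Q = 1"
  then show "otoc_magic n U = 0" by (metis diff_self otoc_magic_attained)
qed

text \<open>With the conjugate of P equal to c R and R Q = s Q R, the product R Q R Q collapses to s
  Q R R Q = s. The correlator is therefore c^2 s, of modulus 1.\<close>

lemma clifford_imp_otoc:
  assumes U: "clifford n U" and P: "P \<in> paulis n" and Q: "Q \<in> paulis n"
  shows "otoc n U P Q = 1"
proof -
  let ?d = "2 ^ n :: nat"
  obtain c R where R: "R \<in> paulis n" "cmod c = 1" "mat_adjoint U * P * U = c \<cdot>\<^sub>m R"
    using cliffordD(2)[OF U P] by blast
  obtain s where s: "cmod s = 1" "R * Q = s \<cdot>\<^sub>m (Q * R)" using pauli_commute[OF R(1) Q] by blast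
  note pc = paulis_carrier[OF R(1)] paulis_carrier[OF Q]
  have "(Q * R) * (R * Q) = Q * Q"
    using pc pauli_square[OF R(1)] by (intro cancel_middle[of _ ?d]) auto
  then have RQRQ: "(R * Q) * (R * Q) = s \<cdot>\<^sub>m 1\<^sub>m ?d"
    using pc pauli_square[OF Q] s(2) mult_smult_assoc_mat[of "Q * R" ?d ?d "R * Q" ?d s] by simp
  have "(c \<cdot>\<^sub>m R) * Q * (c \<cdot>\<^sub>m R) * Q = (c * c) \<cdot>\<^sub>m ((R * Q) * (R * Q))"
    using pc by (simp add: square_mat_simps[where d = ?d] smult_smult_mat)
  also have "\<dots> = (c * c * s) \<cdot>\<^sub>m 1\<^sub>m ?d" by (simp add: RQRQ smult_smult_mat)
  finally show ?thesis
    using R s by (simp add: otoc_def norm_trace_smult[of _ ?d] norm_trace_one norm_mult)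
qed

lemma clifford_if_otoc:
  assumes U: "qubit_unitary n U"
    and 1: "\<And>P Q. P \<in> paulis n \<Longrightarrow> Q \<in> paulis n \<Longrightarrow> otoc n U P Q = 1"
  shows "clifford n U"
proof -
  let ?d = "2 ^ n :: nat"
  have "\<exists>c. \<exists>Q\<in>paulis n. cmod c = 1 \<and> mat_adjoint U * P * U = c \<cdot>\<^sub>m Q" if P: "P \<in> paulis n" for P
  proof (rule pauli_phase_if_commutes[OF conjugate_unitary[OF U P]])
    fix Q assume Q: "Q \<in> paulis n"
    define W where "W = mat_adjoint U * P * U"
    have W: "W \<in> carrier_mat ?d ?d"
      using conjugate_unitary[OF U P] by (simp add: W_def qubit_unitary_def)
    note pc = paulis_carrier[OF P] paulis_carrier[OF Q]
    note uc = qubit_unitaryD(1)[OF U]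
    have WW: "W * W = 1\<^sub>m ?d"
      unfolding W_def conjugate_mult[OF U pc(1) pc(1)] pauli_square[OF P]
      using uc qubit_unitaryD(2)[OF U] by simp
    obtain l where l: "W * Q * W * Q = l \<cdot>\<^sub>m 1\<^sub>m ?d"
      using unitary_scalar_if_norm_trace[OF otoc_unitary[OF U P Q]] 1[OF P Q]
      unfolding otoc_def W_def by blast
    have "(Q * W) * (W * Q) = Q * Q"
      using pc W WW by (intro cancel_middle[of _ ?d]) auto
    then have "(W * Q) * ((W * Q) * (Q * W)) = W * Q"
      using cancel_middle[of W ?d Q Q W] pc W WW pauli_square[OF Q] by simp
    \<comment> \<open>W and Q are involutions, so Q W is the inverse of W Q; multiplying by it turns
      the scalar W Q W Q into a commutation relation.\<close>
    then have "W * Q = (W * Q * W * Q) * (Q * W)"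
      using pc W by (simp add: square_mat_simps[where d = ?d])
    also have "\<dots> = l \<cdot>\<^sub>m (Q * W)"
      unfolding l using pc W by (simp add: square_mat_simps[where d = ?d])
    finally show "\<exists>l. mat_adjoint U * P * U * Q = l \<cdot>\<^sub>m (Q * (mat_adjoint U * P * U))"
      unfolding W_def ..
  qed
  then show ?thesis unfolding clifford_def using U by blast
qed

lemma otoc_magic_eq_0_iff_clifford:
  "qubit_unitary n U \<Longrightarrow> otoc_magic n U = 0 \<longleftrightarrow> clifford n U"
  using otoc_magic_eq_0_iff clifford_imp_otoc clifford_if_otoc by blast

section \<open>Invariance under Clifford factors\<close>

lemma otoc_clifford_mult:
  assumes V: "qubit_unitary n V" and U1: "clifford n U1" and U2: "clifford n U2"
    and P: "P \<in> paulis n" and Q: "Q \<in> paulis n"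
  obtains P' Q' where "P' \<in> paulis n" "Q' \<in> paulis n"
    "otoc n (U1 * V * U2) P Q = otoc n V P' Q'"
proof -
  let ?d = "2 ^ n :: nat"
  note as = assoc_mult_mat[of _ ?d ?d _ ?d _ ?d]
  obtain a P' where P': "P' \<in> paulis n" "cmod a = 1" "mat_adjoint U1 * P * U1 = a \<cdot>\<^sub>m P'"
    using cliffordD(2)[OF U1 P] by blast
  \<comment> \<open>Q is conjugated in the direction opposite to the one in \<open>clifford\<close>,
    which is why the adjoint of U2 has to be Clifford.\<close>
  obtain b Q' where Q': "Q' \<in> paulis n" "cmod b = 1" "U2 * Q * mat_adjoint U2 = b \<cdot>\<^sub>m Q'"
    using cliffordD(2)[OF clifford_adjoint[OF U2] Q] by auto
  note pc = paulis_carrier[OF P] paulis_carrier[OF Q] paulis_carrier[OF P'(1)] paulis_carrier[OF Q'(1)]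
  note u2 = cliffordD(1)[OF U2]
  note uc = qubit_unitaryD(1)[OF cliffordD(1)[OF U1]] qubit_unitaryD(1)[OF u2] qubit_unitaryD(1)[OF V]
  define W where "W = mat_adjoint V * P' * V"
  have W: "W \<in> carrier_mat ?d ?d" using uc pc by (simp add: W_def square_mat_simps[where d = ?d])
  have "mat_adjoint (U1 * V * U2) = mat_adjoint U2 * (mat_adjoint V * mat_adjoint U1)"
    using uc by (simp add: mat_adjoint_mult[of _ ?d ?d _ ?d] square_mat_simps[where d = ?d])
  then have "mat_adjoint (U1 * V * U2) * P * (U1 * V * U2)
      = mat_adjoint U2 * (mat_adjoint V * (mat_adjoint U1 * P * U1) * V) * U2"
    using uc pc by (simp add: square_mat_simps[where d = ?d])
  also have "\<dots> = a \<cdot>\<^sub>m (mat_adjoint U2 * W * U2)"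
    unfolding P'(3) W_def using uc pc by (simp add: square_mat_simps[where d = ?d])
  finally have W_eq: "mat_adjoint (U1 * V * U2) * P * (U1 * V * U2) = a \<cdot>\<^sub>m (mat_adjoint U2 * W * U2)" .
  \<comment> \<open>Written this way, Q carries the same conjugation by U2 as the evolved P, so the
    whole correlator lies inside one such conjugation.\<close>
  have "Q = b \<cdot>\<^sub>m (mat_adjoint U2 * Q' * U2)"
    using conjugate_cancel[OF u2 pc(2)] uc pc by (simp add: Q'(3) conjugate_smult[of _ ?d])
  then have WQ: "a \<cdot>\<^sub>m (mat_adjoint U2 * W * U2) * Q = (a * b) \<cdot>\<^sub>m (mat_adjoint U2 * (W * Q') * U2)"
    using W pc uc by (simp add: smult_mult_smult_mat[where d = ?d] square_mat_simps(1)[where d = ?d]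
        conjugate_mult[OF u2 W pc(4)])
  let ?K = "mat_adjoint U2 * (W * Q') * U2"
  have K: "?K \<in> carrier_mat ?d ?d" using W pc uc by auto
  have "mat_adjoint (U1 * V * U2) * P * (U1 * V * U2) * Q *
      (mat_adjoint (U1 * V * U2) * P * (U1 * V * U2)) * Q
    = (a \<cdot>\<^sub>m (mat_adjoint U2 * W * U2) * Q) * (a \<cdot>\<^sub>m (mat_adjoint U2 * W * U2) * Q)"
    unfolding W_eq using W pc uc by (intro as) auto
  also have "\<dots> = (a * b * (a * b)) \<cdot>\<^sub>m (?K * ?K)"
    unfolding WQ using K
    by (simp only: square_mat_simps[where d = ?d] smult_carrier_mat smult_smult_mat)
  also have "?K * ?K = mat_adjoint U2 * (W * Q' * W * Q') * U2"
    using conjugate_mult[OF u2, of "W * Q'" "W * Q'"] W pc by (simp add: square_mat_simps[where d = ?d])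
  finally have M: "mat_adjoint (U1 * V * U2) * P * (U1 * V * U2) * Q *
      (mat_adjoint (U1 * V * U2) * P * (U1 * V * U2)) * Q
    = (a * b * (a * b)) \<cdot>\<^sub>m (mat_adjoint U2 * (W * Q' * W * Q') * U2)" .
  have L: "mat_adjoint U2 * (W * Q' * W * Q') * U2 \<in> carrier_mat ?d ?d"
    using W pc uc by (simp add: square_mat_simps(1)[where d = ?d])
  \<comment> \<open>Cyclicity of the trace removes U2; the remaining factor (a b)^2 has modulus
    1.\<close>
  have "mat_trace (mat_adjoint U2 * (W * Q' * W * Q') * U2)
      = mat_trace (U2 * (mat_adjoint U2 * (W * Q' * W * Q')))"
    using W pc uc by (intro mat_trace_mult_commute[of _ ?d ?d]) auto
  also have "U2 * (mat_adjoint U2 * (W * Q' * W * Q')) = (U2 * mat_adjoint U2) * (W * Q' * W * Q')"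
    using W pc uc by (intro as[symmetric]) auto
  also have "\<dots> = W * Q' * W * Q'"
    using W pc qubit_unitaryD(3)[OF u2] by simp
  finally have "norm_trace n (mat_adjoint U2 * (W * Q' * W * Q') * U2) = norm_trace n (W * Q' * W * Q')"
    by (simp only: norm_trace_def)
  then have "otoc n (U1 * V * U2) P Q = cmod (norm_trace n (W * Q' * W * Q'))"
    by (simp only: otoc_def M norm_trace_smult[OF L] norm_mult P'(2) Q'(2) mult_1)
  then show ?thesis by (intro that[OF P'(1) Q'(1)]) (simp add: otoc_def W_def)
qed

text \<open>A maximising pair for the product is sent to some pair for V with the same value, which
  the maximum for V dominates.\<close>

lemma otoc_magic_clifford_mult_le:
  assumes "qubit_unitary n V" "clifford n U1" "clifford n U2"
  shows "otoc_magic n (U1 * V * U2) \<le> otoc_magic n V"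
proof -
  obtain P Q where PQ: "P \<in> paulis n" "Q \<in> paulis n"
    and eq: "otoc_magic n (U1 * V * U2) = 1 - otoc n (U1 * V * U2) P Q"
    by (rule otoc_magic_attained)
  obtain P' Q' where "P' \<in> paulis n" "Q' \<in> paulis n"
    "otoc n (U1 * V * U2) P Q = otoc n V P' Q'"
    by (rule otoc_clifford_mult[OF assms PQ])
  then show ?thesis using otoc_magic_ge[of P' n Q' V] eq by simp
qed

lemma otoc_magic_clifford_mult:
  assumes V: "qubit_unitary n V" and U1: "clifford n U1" and U2: "clifford n U2"
  shows "otoc_magic n (U1 * V * U2) = otoc_magic n V"
proof (rule antisym)
  let ?d = "2 ^ n :: nat"
  note u = cliffordD(1)[OF U1] cliffordD(1)[OF U2]
  note uc = qubit_unitaryD(1)[OF u(1)] qubit_unitaryD(1)[OF u(2)] qubit_unitaryD(1)[OF V]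
  \<comment> \<open>V is recovered from U1 V U2 by multiplying with adjoints, again Clifford; the
    one-sided bound for these factors is the reverse inequality.\<close>
  have "mat_adjoint U1 * (U1 * V * U2) * mat_adjoint U2
     = (mat_adjoint U1 * U1) * V * (U2 * mat_adjoint U2)"
    using uc by (simp add: square_mat_simps[where d = ?d])
  also have "\<dots> = V" using uc qubit_unitaryD(2)[OF u(1)] qubit_unitaryD(3)[OF u(2)] by simp
  finally show "otoc_magic n V \<le> otoc_magic n (U1 * V * U2)"
    using otoc_magic_clifford_mult_le[OF qubit_unitary_mult[OF qubit_unitary_mult[OF u(1) V] u(2)]
        clifford_adjoint[OF U1] clifford_adjoint[OF U2]] by simp
qed (rule otoc_magic_clifford_mult_le[OF assms])

theorem mainTheorem2:
  fixes n :: nat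
  assumes "n \<ge> 1"
  shows "(\<forall>V. qubit_unitary n V \<longrightarrow> otoc_magic n V \<ge> 0)
    \<and> (\<forall>U. qubit_unitary n U \<longrightarrow> (otoc_magic n U = 0 \<longleftrightarrow> clifford n U))
    \<and> (\<forall>V U1 U2. qubit_unitary n V \<longrightarrow> clifford n U1 \<longrightarrow> clifford n U2
          \<longrightarrow> otoc_magic n (U1 * V * U2) = otoc_magic n V)"
  by (intro conjI allI impI otoc_magic_nonneg otoc_magic_eq_0_iff_clifford otoc_magic_clifford_mult)

end
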